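(* Let $\epsilon>0$. There is a constant $C>0$ such that for almost all primes $p$ one has $h(p)\leq C(\log_3 p)^2$; that is, the set of primes $p$ satisfying this inequality has relative density $1$ in the set of all primes: $$\lim_{x\to\infty}\frac{\#\{p\leq x \text{ prime} : h(p)\leq C(\log_3 p)^2\}}{\#\{p\leq x \text{ prime}\}}=1.$$
   Context: $\log_3 p=\log\log\log p$ is the three times iterated logarithm (defined for $p$ large enough; the finitely many primes for which it is undefined may be ignored). For a fixed $\epsilon>0$ and a prime $p$, $h(p)$ (which depends on $\epsilon$) denotes the least number of positive integers smaller than $p^{\frac{1}{4\sqrt{e}}+\epsilon}$ whose residue classes modulo $p$ generate the multiplicative group $\mathbb{F}_p^{*}$ (such a generating set exists for all sufficiently large $p$). *)

theory Defs
  imports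
    "HOL-Analysis.Analysis"
    "HOL-Algebra.Generated_Groups"
    "HOL-Number_Theory.Residues"
begin

definition residue_units :: "nat \<Rightarrow> int monoid" where
  "residue_units p = units_of (residue_ring (int p))"

(* The candidate elements are the integers below the bound that are prime to p: for large \<epsilon> the
   bound exceeds p, and multiples of p have no residue class in the multiplicative group. *)
definition small_generating_set :: "real \<Rightarrow> nat \<Rightarrow> nat set \<Rightarrow> bool" where
  "small_generating_set \<epsilon> p S \<longleftrightarrow>
     (\<forall>a\<in>S. 0 < a \<and> real a < real p powr (1 / (4 * sqrt (exp 1)) + \<epsilon>) \<and> coprime a p) \<and>
     generate (residue_units p) ((\<lambda>a. int a mod int p) ` S) = carrier (residue_units p)"

(* A set S as above is bounded, hence finite, so card counts correctly. The value is \<infinity> if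
   there is no such S (possible only for finitely many primes). *)
definition h :: "real \<Rightarrow> nat \<Rightarrow> enat" where
  "h \<epsilon> p = (INF S \<in> {S. small_generating_set \<epsilon> p S}. enat (card S))"

definition log3 :: "real \<Rightarrow> real" where
  "log3 x = ln (ln (ln x))"

definition almost_all_primes :: "(nat \<Rightarrow> bool) \<Rightarrow> bool" where
  "almost_all_primes P \<longleftrightarrow>
     ((\<lambda>x::real. real (card {p::nat. prime p \<and> real p \<le> x \<and> P p}) /
                 real (card {p::nat. prime p \<and> real p \<le> x})) \<longlongrightarrow> 1) at_top"

end

theory Submission
  imports Defs "HOL-Real_Asymp.Real_Asymp"
begin

text \<open>
  For almost all primes \<open>p\<close> a bounded number of small generators suffices, and then the triple
  logarithm takes care of the constant. The reason is probabilistic: two random elements of a cyclic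
  group generate it with a probability bounded away from zero, since they fail only if both lie in
  the subgroup of index \<open>q\<close> for some prime \<open>q\<close>, and the sum of \<open>1 / q\<^sup>2\<close> over all primes is less than 1.

  To use this with small integers, let \<open>A\<close> be the set of products of 48 distinct primes up to
  \<open>y = x powr (1/16)\<close>. It is a rather dense set of integers up to \<open>x ^ 3\<close>, and a large sieve inequality
  (\<open>large_sieve\<close>) shows that for all but \<open>O(sqrt x)\<close> primes \<open>p \<le> x\<close> it is so well distributed modulo
  \<open>p\<close> that two random elements of \<open>A\<close> behave like two random residues
  (\<open>exists_two_elements_not_powers\<close>). For such \<open>p\<close> the prime factors of two suitable
  elements of \<open>A\<close> generate all units (\<open>exists_generating_primes\<close>). These are at most 96 primes, and
  for \<open>p > sqrt x\<close> they are below \<open>p powr (1/8)\<close>, where \<open>1/8 < 1 / (4 * sqrt (exp 1))\<close>.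

  No character sums are involved. The large sieve is needed only with \<open>Q ^ 3\<close> in place of \<open>Q\<^sup>2\<close>, and in
  this form it follows from duality and the Chinese remainder theorem. Chebyshev's lower bound for
  the number of primes ensures both that \<open>A\<close> is large and that \<open>O(sqrt x)\<close> exceptions have relative
  density zero.
\<close>

section \<open>Chebyshev's lower bound for the number of primes\<close>

text \<open>
  The entries \<open>1 / ((n + 1) * (n choose k))\<close> of the Leibniz harmonic triangle satisfy
  \<open>1 / ((n + 1) * (n choose (k + 1))) = 1 / (n * (n - 1 choose k)) - 1 / ((n + 1) * (n choose k))\<close>.
  Multiplied by the least common multiple, both terms on the right are integers by induction on
  \<open>k\<close>, and therefore so is the term on the left.
\<close>

lemma Leibniz_triangle_dvd_Lcm:
  assumes "k \<le> n"
  shows "Suc n * (n choose k) dvd Lcm {1..Suc n}"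
  using assms
proof (induction k arbitrary: n)
  case 0
  then show ?case by (simp add: dvd_Lcm)
next
  case (Suc k)
  then obtain m where n: "n = Suc m" and km: "k \<le> m"
    by (cases n) auto
  define L where "L = Lcm {1..Suc n}"
  define c where "c = m choose k"
  have "Suc m * c dvd Lcm {1..Suc m}"
    using Suc.IH[OF km] by (simp add: c_def)
  also have "\<dots> dvd L"
    unfolding L_def n by (intro Lcm_subset) auto
  finally obtain u where u: "L = Suc m * c * u" by (elim dvdE)
  have "Suc n * (n choose k) dvd L"
    unfolding L_def using km by (intro Suc.IH) (simp add: n)
  then obtain v where v: "L = Suc n * (n choose k) * v" by (elim dvdE)
  have c: "c > 0" using km by (simp add: c_def)
  have b1: "Suc k * (n choose Suc k) = Suc m * c"
    unfolding n c_def by (metis Suc_times_binomial mult.commute)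
  have b2: "(Suc m - k) * (n choose k) = Suc m * c"
    unfolding n c_def using binomial_absorb_comp[of "Suc m" k] by simp
  have r1: "real (n choose Suc k) = real (Suc m) * real c / real (Suc k)"
    using arg_cong[OF b1, of real] by (simp add: field_simps)
  have "real (Suc m - k) * real (n choose k) = real (Suc m) * real c"
    using arg_cong[OF b2, of real] by (metis of_nat_mult)
  moreover have "real (Suc m - k) = real m + 1 - real k" "real m + 1 - real k > 0"
    using km by auto
  ultimately have r2: "real (n choose k) = real (Suc m) * real c / (real m + 1 - real k)"
    by (simp add: field_simps)
  have u': "real u = real L / (real (Suc m) * real c)"
    using c unfolding u of_nat_mult by (intro nonzero_mult_div_cancel_left[symmetric]) simp
  have "real (Suc n) * real (n choose k) \<noteq> 0" using km n by simp
  then have v': "real v = real L / (real (Suc n) * real (n choose k))"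
    unfolding v of_nat_mult by (rule nonzero_mult_div_cancel_left[symmetric])
  have "real (Suc n * (n choose Suc k)) * (real u - real v) = real L"
  proof -
    \<comment> \<open>The recurrence of the triangle, with \<open>M = m + 1\<close>, \<open>d = k + 1\<close>, \<open>t = m + 1 - k\<close> and \<open>t + d = n + 1\<close>.\<close>
    have id: "(t + d) * (M * x / d) * (y / (M * x) - y / ((t + d) * (M * x / t))) = y"
      if "t > 0" "d > 0" "M > 0" "x > 0" for t d M x y :: real
    proof -
      have "t + d \<noteq> 0" using that by simp
      then have "y / (M * x) - y / ((t + d) * (M * x / t)) = y * d / ((t + d) * (M * x))"
        using that by (simp add: divide_simps) (simp add: algebra_simps)
      then show ?thesis using that \<open>t + d \<noteq> 0\<close> by simp
    qed
    have "real (Suc n) = (real m + 1 - real k) + real (Suc k)" by (simp add: n)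
    then show ?thesis
      unfolding u' v' of_nat_mult r1 r2
      using id[of "real m + 1 - real k" "real (Suc k)" "real (Suc m)" "real c" "real L"]
        c \<open>real m + 1 - real k > 0\<close> by simp
  qed
  then have "real_of_int (int L) = real_of_int (int (Suc n * (n choose Suc k)) * (int u - int v))"
    by (simp only: of_int_mult of_int_diff of_int_of_nat_eq)
  then have "int L = int (Suc n * (n choose Suc k)) * (int u - int v)"
    by (simp only: of_int_eq_iff)
  then have "int (Suc n * (n choose Suc k)) dvd int L" by (rule dvdI)
  then show ?case unfolding L_def using int_dvd_int_iff by blast
qed

text \<open>
  Each prime \<open>p \<le> m\<close> contributes to the least common multiple a power of \<open>p\<close> that divides one of
  the numbers up to \<open>m\<close>, hence a factor of at most \<open>m\<close>.
\<close>

lemma Lcm_le_power_card_primes: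
  assumes "m > 0"
  shows "Lcm {1..m} \<le> m ^ card {p::nat. prime p \<and> p \<le> m}"
proof -
  define P where "P = {p::nat. prime p \<and> p \<le> m}"
  define e where "e p = Max ((\<lambda>j. multiplicity p j) ` {1..m})" for p :: nat
  have finP: "finite P" by (simp add: P_def)
  have "Lcm {1..m} dvd (\<Prod>p\<in>P. p ^ e p)"
  proof (rule Lcm_least)
    fix j assume j: "j \<in> {1..m}"
    have "j = (\<Prod>p\<in>prime_factors j. p ^ multiplicity p j)"
      using j by (intro prime_factorization_nat) auto
    also have "\<dots> dvd (\<Prod>p\<in>prime_factors j. p ^ e p)"
      unfolding e_def using j by (intro prod_dvd_prod le_imp_power_dvd Max_ge) auto
    also have "\<dots> dvd (\<Prod>p\<in>P. p ^ e p)"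
      using finP j by (intro prod_dvd_prod_subset)
        (auto simp: P_def in_prime_factors_iff dest!: dvd_imp_le)
    finally show "j dvd (\<Prod>p\<in>P. p ^ e p)" .
  qed
  moreover have "(\<Prod>p\<in>P. p ^ e p) > 0"
    by (intro prod_pos) (auto simp: P_def prime_gt_0_nat)
  ultimately have "Lcm {1..m} \<le> (\<Prod>p\<in>P. p ^ e p)" by (rule dvd_imp_le)
  also have "\<dots> \<le> (\<Prod>p\<in>P. m)"
  proof (intro prod_mono conjI)
    fix p assume "p \<in> P"
    have "e p \<in> (\<lambda>j. multiplicity p j) ` {1..m}"
      unfolding e_def using assms by (intro Max_in) auto
    then obtain j where j: "j \<in> {1..m}" "e p = multiplicity p j" by auto
    have "p ^ e p dvd j" unfolding j(2) by (rule multiplicity_dvd)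
    then show "p ^ e p \<le> m" using j(1) by (auto dest!: dvd_imp_le)
  qed auto
  also have "\<dots> = m ^ card P" by simp
  finally show ?thesis unfolding P_def .
qed

text \<open>
  The central coefficient is the largest of the \<open>n + 1\<close> binomial coefficients, whose sum is
  \<open>2 ^ n\<close>. So \<open>2 ^ n\<close> is at most \<open>(n + 1) * (n choose (n div 2))\<close>, an entry of the
  reciprocal Leibniz triangle, which the two preceding lemmas bound.
\<close>

lemma two_power_le_power_card_primes:
  "2 ^ n \<le> Suc n ^ card {p::nat. prime p \<and> p \<le> Suc n}"
proof -
  have "(2::nat) ^ n = (\<Sum>k\<le>n. n choose k)" by (simp add: choose_row_sum)
  also have "\<dots> \<le> (\<Sum>k\<le>n. n choose (n div 2))" by (intro sum_mono binomial_maximum)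
  also have "\<dots> = Suc n * (n choose (n div 2))" by simp
  also have "\<dots> \<le> Lcm {1..Suc n}"
  proof (rule dvd_imp_le)
    show "Suc n * (n choose (n div 2)) dvd Lcm {1..Suc n}"
      by (rule Leibniz_triangle_dvd_Lcm) simp
  qed (auto intro!: Nat.gr0I)
  also have "\<dots> \<le> Suc n ^ card {p::nat. prime p \<and> p \<le> Suc n}"
    by (rule Lcm_le_power_card_primes) simp
  finally show ?thesis .
qed

text \<open>
  Chebyshev's lower bound for the number of primes. It serves twice: for the supply of small primes,
  and for comparing the number of exceptional primes with that of all primes.
\<close>

lemma card_primes_lower_bound:
  fixes x :: real
  assumes "x \<ge> 2"
  shows "(x - 2) * ln 2 / ln x \<le> real (card {p::nat. prime p \<and> real p \<le> x})"
proof -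
  define n where "n = nat \<lfloor>x\<rfloor> - 1"
  have n: "real (Suc n) \<le> x" "x < real n + 2" using assms unfolding n_def by linarith+
  have P: "{p::nat. prime p \<and> p \<le> Suc n} = {p::nat. prime p \<and> real p \<le> x}"
  proof -
    have "p \<le> Suc n \<longleftrightarrow> real p \<le> x" for p :: nat using n by linarith
    then show ?thesis by simp
  qed
  define c where "c = card {p::nat. prime p \<and> real p \<le> x}"
  have "real (2 ^ n) \<le> real (Suc n ^ c)"
    using two_power_le_power_card_primes[of n] unfolding P c_def[symmetric] of_nat_le_iff .
  also have "\<dots> \<le> x ^ c" using n by (simp add: power_mono)
  finally have "ln (2 ^ n :: real) \<le> ln (x ^ c)" using assms by (subst ln_le_cancel_iff) auto
  then have "real n * ln 2 \<le> real c * ln x" using assms by (simp add: ln_realpow)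
  moreover have "(x - 2) * ln 2 \<le> real n * ln 2" using n by (intro mult_right_mono) auto
  ultimately have "(x - 2) * ln 2 \<le> real c * ln x" by linarith
  then show ?thesis using assms by (simp add: c_def divide_simps)
qed

section \<open>The large sieve for residue classes\<close>

lemma sum_mod_lessThan:
  fixes f :: "nat \<Rightarrow> real"
  shows "(\<Sum>n<N. f (n mod m)) = real (N div m) * (\<Sum>r<m. f r) + (\<Sum>r<N mod m. f r)"
proof -
  have "(\<Sum>n<r + k * m. f (n mod m)) = real k * (\<Sum>r<m. f r) + (\<Sum>n<r. f (n mod m))" for k r
  proof (induction k)
    case (Suc k)
    have "(\<Sum>n<m + (r + k * m). f (n mod m))
        = (\<Sum>n<m. f (n mod m)) + (\<Sum>n = m..<m + (r + k * m). f (n mod m))"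
      unfolding lessThan_atLeast0 by (rule sum.atLeastLessThan_concat[symmetric]) auto
    also have "(\<Sum>n = m..<m + (r + k * m). f (n mod m)) = (\<Sum>n<r + k * m. f (n mod m))"
      using sum.shift_bounds_nat_ivl[of "\<lambda>n. f (n mod m)" 0 m "r + k * m"]
      by (simp add: lessThan_atLeast0 add.commute)
    also have "(\<Sum>n<m. f (n mod m)) = (\<Sum>n<m. f n)" by (intro sum.cong) auto
    finally show ?case using Suc.IH by (simp add: algebra_simps)
  qed auto
  from this[of "N mod m" "N div m"]
  have "(\<Sum>n<N. f (n mod m)) = real (N div m) * (\<Sum>r<m. f r) + (\<Sum>n<N mod m. f (n mod m))"
    by (simp add: add.commute)
  also have "(\<Sum>n<N mod m. f (n mod m)) = (\<Sum>n<N mod m. f n)"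
    by (cases "m = 0") (auto intro!: sum.cong mod_less dest: less_trans[OF _ mod_less_divisor])
  finally show ?thesis .
qed

lemma sum_residue_classes:
  fixes g :: "nat \<Rightarrow> real"
  assumes "finite A" "p > 0"
  shows "(\<Sum>n\<in>A. g (n mod p)) = (\<Sum>h<p. real (card {n\<in>A. n mod p = h}) * g h)"
proof -
  have "(\<Sum>n\<in>A. g (n mod p)) = (\<Sum>h<p. \<Sum>n | n \<in> A \<and> n mod p = h. g (n mod p))"
    using assms by (intro sum.group[symmetric]) auto
  also have "\<dots> = (\<Sum>h<p. \<Sum>n | n \<in> A \<and> n mod p = h. g h)"
    by (intro sum.cong) auto
  also have "\<dots> = (\<Sum>h<p. real (card {n\<in>A. n mod p = h}) * g h)"
    by simp
  finally show ?thesis .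
qed

text \<open>
  By the Chinese remainder theorem the summand has period \<open>p * q\<close>, and its sum over a full period
  is the product of the two residue sums, hence zero. Only an incomplete period remains, and in it
  each pair of residues occurs at most once. This quasi-orthogonality of different prime moduli,
  with an error independent of \<open>N\<close>, is what makes the large sieve work.
\<close>

lemma abs_sum_two_moduli_le:
  fixes f g :: "nat \<Rightarrow> real"
  assumes cop: "coprime p q" and p: "p > 0" and q: "q > 0" and f: "(\<Sum>h<p. f h) = 0"
  shows "\<bar>\<Sum>n<N. f (n mod p) * g (n mod q)\<bar> \<le> (\<Sum>h<p. \<bar>f h\<bar>) * (\<Sum>h<q. \<bar>g h\<bar>)"
proof -
  define F where "F n = f (n mod p) * g (n mod q)" for n
  define crt where "crt n = (n mod p, n mod q)" for n :: nat
  have inj: "inj_on crt {..<p * q}"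
  proof (rule inj_onI)
    fix a b assume ab: "a \<in> {..<p * q}" "b \<in> {..<p * q}" "crt a = crt b"
    then have "[a = b] (mod p)" "[a = b] (mod q)" by (auto simp: crt_def cong_def)
    then have "[a = b] (mod p * q)" using cop by (simp add: coprime_cong_mult_nat)
    with ab show "a = b" by (simp add: cong_def)
  qed
  have sub: "crt ` {..<p * q} \<subseteq> {..<p} \<times> {..<q}" using p q by (auto simp: crt_def)
  have "card (crt ` {..<p * q}) = card ({..<p} \<times> {..<q})" using inj by (simp add: card_image)
  then have img: "crt ` {..<p * q} = {..<p} \<times> {..<q}" using sub by (intro card_subset_eq) auto
  have "(\<Sum>n<p * q. F n) = (\<Sum>(a, b)\<in>crt ` {..<p * q}. f a * g b)"
    unfolding sum.reindex[OF inj] by (simp add: F_def crt_def)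
  also have "\<dots> = (\<Sum>h<p. f h) * (\<Sum>h<q. g h)"
    unfolding img by (simp add: sum.cartesian_product[symmetric] sum_product)
  finally have full: "(\<Sum>n<p * q. F n) = 0" using f by simp
  have "(\<Sum>n<N. F n) = (\<Sum>n<N. F (n mod (p * q)))"
    by (simp add: F_def mod_mod_cancel)
  also have "\<dots> = (\<Sum>r<N mod (p * q). F r)"
    unfolding sum_mod_lessThan full by simp
  finally have "\<bar>\<Sum>n<N. F n\<bar> \<le> (\<Sum>r<N mod (p * q). \<bar>F r\<bar>)" by (simp add: sum_abs)
  also have "\<dots> \<le> (\<Sum>r<p * q. \<bar>F r\<bar>)"
    using p q by (intro sum_mono2) (auto intro: less_trans[OF _ mod_less_divisor])
  also have "\<dots> = (\<Sum>(a, b)\<in>crt ` {..<p * q}. \<bar>f a\<bar> * \<bar>g b\<bar>)"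
    unfolding sum.reindex[OF inj] by (simp add: F_def crt_def abs_mult)
  also have "\<dots> = (\<Sum>h<p. \<bar>f h\<bar>) * (\<Sum>h<q. \<bar>g h\<bar>)"
    unfolding img by (simp add: sum.cartesian_product[symmetric] sum_product)
  finally show ?thesis by (simp add: F_def)
qed

definition discrepancy :: "nat set \<Rightarrow> nat \<Rightarrow> nat \<Rightarrow> real" where
  "discrepancy A p r = real (card {n\<in>A. n mod p = r}) - real (card A) / real p"

text \<open>
  The factor \<open>p\<close> is the weight that each modulus has in the arithmetic large sieve.
\<close>

definition residue_variance :: "nat set \<Rightarrow> nat \<Rightarrow> real" where
  "residue_variance A p = real p * (\<Sum>h<p. (discrepancy A p h)\<^sup>2)"

lemma residue_variance_nonneg: "residue_variance A p \<ge> 0"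
  by (simp add: residue_variance_def sum_nonneg)

lemma sum_discrepancy:
  assumes "finite A" "p > 0"
  shows "(\<Sum>h<p. discrepancy A p h) = 0"
  using sum_residue_classes[OF assms, of "\<lambda>_. 1"] assms(2)
  by (simp add: discrepancy_def sum_subtractf)

text \<open>
  The variance is a linear functional of the set \<open>A\<close> once the discrepancies are held fixed. This is
  the duality step of the large sieve.
\<close>

lemma sum_discrepancy_mod:
  assumes "finite A" "p > 0"
  shows "real p * (\<Sum>n\<in>A. discrepancy A p (n mod p)) = residue_variance A p"
proof -
  have "(\<Sum>n\<in>A. discrepancy A p (n mod p))
      = (\<Sum>h<p. (discrepancy A p h + real (card A) / real p) * discrepancy A p h)"
    unfolding sum_residue_classes[OF assms, of "discrepancy A p"]
    by (intro sum.cong refl) (simp add: discrepancy_def)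
  also have "\<dots> = (\<Sum>h<p. (discrepancy A p h)\<^sup>2) + real (card A) / real p * (\<Sum>h<p. discrepancy A p h)"
    by (simp add: distrib_right sum.distrib sum_distrib_left power2_eq_square)
  finally show ?thesis by (simp add: sum_discrepancy[OF assms] residue_variance_def)
qed

lemma sum_abs_discrepancy_le:
  "(\<Sum>h<p. \<bar>discrepancy A p h\<bar>) \<le> sqrt (residue_variance A p)"
proof (rule real_le_rsqrt)
  show "(\<Sum>h<p. \<bar>discrepancy A p h\<bar>)\<^sup>2 \<le> residue_variance A p"
    using Cauchy_Schwarz_ineq_sum[of "\<lambda>_. 1" "\<lambda>h. \<bar>discrepancy A p h\<bar>" "{..<p}"]
    by (simp add: residue_variance_def)
qed

text \<open>
  Let \<open>E\<close> be the sum of the variances. By duality it is the sum over \<open>A\<close> of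
  \<open>F n = (\<Sum>p\<in>P. p * discrepancy A p (n mod p))\<close>, so by Cauchy-Schwarz \<open>E\<^sup>2\<close> is at most
  \<open>card A\<close> times the sum of \<open>(F n)\<^sup>2\<close> over all \<open>n < N\<close>. Expand this square: the diagonal terms give
  \<open>(N + Q) * E\<close>, and the terms with two different primes give at most \<open>Q ^ 3 * E\<close> by
  quasi-orthogonality. Dividing by \<open>E\<close> yields the bound. The term \<open>Q ^ 3\<close>, instead of the optimal
  \<open>Q\<^sup>2\<close>, is harmless when \<open>N\<close> may be taken of that size.
\<close>

theorem large_sieve:
  assumes A: "A \<subseteq> {..<N}" and P: "P \<subseteq> {1..Q}" and prime: "\<And>p. p \<in> P \<Longrightarrow> prime p"
  shows "(\<Sum>p\<in>P. residue_variance A p) \<le> real (N + Q + Q ^ 3) * real (card A)"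
proof -
  define D where "D = discrepancy A"
  define V where "V = residue_variance A"
  define E where "E = (\<Sum>p\<in>P. V p)"
  define F where "F n = (\<Sum>p\<in>P. real p * D p (n mod p))" for n
  have finA: "finite A" and finP: "finite P"
    using A P by (auto intro: finite_subset)
  have pos: "p > 0" if "p \<in> P" for p using P that by auto
  have V0: "V p \<ge> 0" for p by (simp add: V_def residue_variance_nonneg)
  have E0: "E \<ge> 0" unfolding E_def by (intro sum_nonneg V0)
  have E_eq: "E = (\<Sum>n\<in>A. F n)"
  proof -
    have "(\<Sum>n\<in>A. F n) = (\<Sum>p\<in>P. real p * (\<Sum>n\<in>A. D p (n mod p)))"
      unfolding F_def by (subst sum.swap) (simp add: sum_distrib_left)
    also have "\<dots> = E"
      unfolding E_def D_def V_def using finA pos by (intro sum.cong refl sum_discrepancy_mod) auto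
    finally show ?thesis by simp
  qed
  have diag: "real p * real p * (\<Sum>n<N. D p (n mod p) * D p (n mod p)) \<le> real (N + Q) * V p"
    if p: "p \<in> P" for p
  proof -
    have "(\<Sum>n<N. D p (n mod p) * D p (n mod p))
        = real (N div p) * (\<Sum>r<p. (D p r)\<^sup>2) + (\<Sum>r<N mod p. (D p r)\<^sup>2)"
      using sum_mod_lessThan[of "\<lambda>r. (D p r)\<^sup>2" p N] by (simp add: power2_eq_square)
    also have "(\<Sum>r<N mod p. (D p r)\<^sup>2) \<le> (\<Sum>r<p. (D p r)\<^sup>2)"
      using pos[OF p] by (intro sum_mono2) (auto intro: less_trans[OF _ mod_less_divisor])
    finally have "real p * real p * (\<Sum>n<N. D p (n mod p) * D p (n mod p))
        \<le> real p * real p * (real (N div p) * (\<Sum>r<p. (D p r)\<^sup>2) + (\<Sum>r<p. (D p r)\<^sup>2))"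
      by (intro mult_left_mono) auto
    also have "\<dots> = real (N div p * p + p) * V p"
      by (simp add: V_def residue_variance_def D_def algebra_simps)
    also have "\<dots> \<le> real (N + Q) * V p"
      using P p div_times_less_eq_dividend[of N p]
      by (intro mult_right_mono V0 of_nat_mono add_mono) auto
    finally show ?thesis .
  qed
  have offdiag: "real p * real q * (\<Sum>n<N. D p (n mod p) * D q (n mod q))
      \<le> (real p * sqrt (V p)) * (real q * sqrt (V q))"
    if pq: "p \<in> P" "q \<in> P" "p \<noteq> q" for p q
  proof -
    have "(\<Sum>n<N. D p (n mod p) * D q (n mod q)) \<le> (\<Sum>h<p. \<bar>D p h\<bar>) * (\<Sum>h<q. \<bar>D q h\<bar>)"
      using pq prime pos unfolding D_def
      by (intro order_trans[OF abs_ge_self abs_sum_two_moduli_le] primes_coprime sum_discrepancy finA) auto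
    also have "\<dots> \<le> sqrt (V p) * sqrt (V q)"
      unfolding D_def V_def
      by (intro mult_mono sum_abs_discrepancy_le sum_nonneg real_sqrt_ge_zero residue_variance_nonneg) auto
    finally have "real p * real q * (\<Sum>n<N. D p (n mod p) * D q (n mod q))
        \<le> real p * real q * (sqrt (V p) * sqrt (V q))"
      by (intro mult_left_mono) auto
    then show ?thesis by (simp add: mult_ac)
  qed
  have "(\<Sum>n<N. (F n)\<^sup>2)
      = (\<Sum>n<N. \<Sum>p\<in>P. \<Sum>q\<in>P. real p * real q * (D p (n mod p) * D q (n mod q)))"
    by (simp add: F_def power2_eq_square sum_product mult_ac)
  also have "\<dots> = (\<Sum>p\<in>P. \<Sum>q\<in>P. real p * real q * (\<Sum>n<N. D p (n mod p) * D q (n mod q)))"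
    unfolding sum_distrib_left
    by (subst sum.swap, rule sum.cong[OF refl], rule sum.swap)
  also have "\<dots> \<le> (\<Sum>p\<in>P. \<Sum>q\<in>P. (if p = q then real (N + Q) * V p else 0)
                    + (real p * sqrt (V p)) * (real q * sqrt (V q)))"
  proof (intro sum_mono)
    fix p q assume "p \<in> P" "q \<in> P"
    then show "real p * real q * (\<Sum>n<N. D p (n mod p) * D q (n mod q))
      \<le> (if p = q then real (N + Q) * V p else 0) + (real p * sqrt (V p)) * (real q * sqrt (V q))"
      using diag[of p] offdiag[of p q] V0[of p]
      by (cases "p = q") (auto intro: add_increasing2)
  qed
  also have "\<dots> = real (N + Q) * E + (\<Sum>p\<in>P. real p * sqrt (V p))\<^sup>2"
    unfolding sum.distrib power2_eq_square sum_product using finP by (simp add: E_def sum_distrib_left)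
  also have "(\<Sum>p\<in>P. real p * sqrt (V p))\<^sup>2 \<le> (\<Sum>p\<in>P. (real p)\<^sup>2) * (\<Sum>p\<in>P. (sqrt (V p))\<^sup>2)"
    by (rule Cauchy_Schwarz_ineq_sum)
  also have "(\<Sum>p\<in>P. (sqrt (V p))\<^sup>2) = E" using V0 by (simp add: E_def)
  also have "(\<Sum>p\<in>P. (real p)\<^sup>2) \<le> real (Q ^ 3)"
  proof -
    have "(\<Sum>p\<in>P. (real p)\<^sup>2) \<le> (\<Sum>p\<in>{1..Q}. (real Q)\<^sup>2)"
      using P finP by (intro sum_le_included[where i = id]) (auto intro!: power_mono)
    then show ?thesis by (simp add: power3_eq_cube power2_eq_square)
  qed
  finally have sumF: "(\<Sum>n<N. (F n)\<^sup>2) \<le> real (N + Q + Q ^ 3) * E"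
    using E0 by (simp add: mult_right_mono distrib_right)
  have "E\<^sup>2 \<le> (\<Sum>n\<in>A. 1\<^sup>2) * (\<Sum>n\<in>A. (F n)\<^sup>2)"
    unfolding E_eq using Cauchy_Schwarz_ineq_sum[of "\<lambda>_. 1" F A] by simp
  also have "\<dots> \<le> real (card A) * (\<Sum>n<N. (F n)\<^sup>2)"
    using A by (auto intro!: mult_left_mono sum_mono2)
  also have "\<dots> \<le> real (card A) * (real (N + Q + Q ^ 3) * E)"
    using sumF by (intro mult_left_mono) auto
  finally have "E * E \<le> (real (N + Q + Q ^ 3) * real (card A)) * E"
    by (simp only: power2_eq_square mult_ac)
  then have "E \<le> real (N + Q + Q ^ 3) * real (card A)"
    using E0 by (cases "E = 0") (auto simp: mult_le_cancel_right)
  then show ?thesis by (simp add: E_def V_def)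
qed

text \<open>
  A set with small variance modulo \<open>p\<close> meets every union of residue classes about as often as a
  random set would.
\<close>

lemma card_mod_in_le:
  assumes finA: "finite A" and p: "p > 0" and H: "H \<subseteq> {..<p}"
  shows "real (card {n\<in>A. n mod p \<in> H})
    \<le> real (card H) * real (card A) / real p + sqrt (real (card H) / real p * residue_variance A p)"
proof -
  have finH: "finite H" using H finite_subset by blast
  have "real (card {n\<in>A. n mod p \<in> H}) = (\<Sum>n\<in>A. indicator H (n mod p))"
    using finA by (simp add: indicator_def sum.If_cases Collect_conj_eq)
  also have "\<dots> = (\<Sum>h<p. real (card {n\<in>A. n mod p = h}) * indicator H h)"
    by (rule sum_residue_classes[OF finA p])
  also have "\<dots> = (\<Sum>h\<in>H. real (card {n\<in>A. n mod p = h}))"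
    using H by (simp add: indicator_def if_distrib sum.If_cases Int_absorb1 cong: if_cong)
  also have "\<dots> = real (card H) * real (card A) / real p + (\<Sum>h\<in>H. discrepancy A p h)"
    by (simp add: discrepancy_def sum_subtractf)
  also have "(\<Sum>h\<in>H. discrepancy A p h) \<le> sqrt (real (card H) / real p * residue_variance A p)"
  proof (rule real_le_rsqrt)
    have "(\<Sum>h\<in>H. discrepancy A p h)\<^sup>2 \<le> real (card H) * (\<Sum>h\<in>H. (discrepancy A p h)\<^sup>2)"
      using Cauchy_Schwarz_ineq_sum[of "\<lambda>_. 1" "discrepancy A p" H] by simp
    also have "\<dots> \<le> real (card H) * (\<Sum>h<p. (discrepancy A p h)\<^sup>2)"
      using H by (intro mult_left_mono sum_mono2) auto
    finally show "(\<Sum>h\<in>H. discrepancy A p h)\<^sup>2 \<le> real (card H) / real p * residue_variance A p"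
      using p by (simp add: residue_variance_def)
  qed
  finally show ?thesis by simp
qed

text \<open>
  Markov's inequality applied to the large sieve.
\<close>

lemma card_large_variance_le:
  assumes A: "A \<subseteq> {..<N}" and A0: "A \<noteq> {}" and \<delta>: "\<delta> > 0"
  shows "real (card {p. prime p \<and> p \<le> Q \<and> residue_variance A p > (\<delta> * real (card A))\<^sup>2})
    \<le> real (N + Q + Q ^ 3) / (\<delta>\<^sup>2 * real (card A))"
proof -
  define T where "T = {p. prime p \<and> p \<le> Q \<and> residue_variance A p > (\<delta> * real (card A))\<^sup>2}"
  have a: "real (card A) > 0" using A A0 by (auto simp: card_gt_0_iff intro: finite_subset)
  have "real (card T) * (\<delta> * real (card A))\<^sup>2 = (\<Sum>p\<in>T. (\<delta> * real (card A))\<^sup>2)" by simp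
  also have "\<dots> \<le> (\<Sum>p\<in>T. residue_variance A p)" by (intro sum_mono) (auto simp: T_def)
  also have "\<dots> \<le> real (N + Q + Q ^ 3) * real (card A)"
  proof (rule large_sieve[OF A])
    show "T \<subseteq> {1..Q}" by (auto simp: T_def dest: prime_gt_0_nat)
  qed (auto simp: T_def)
  finally have "(real (card T) * (\<delta>\<^sup>2 * real (card A))) * real (card A)
      \<le> real (N + Q + Q ^ 3) * real (card A)"
    by (simp add: power2_eq_square mult_ac)
  then have "real (card T) * (\<delta>\<^sup>2 * real (card A)) \<le> real (N + Q + Q ^ 3)"
    using a by (simp only: mult_le_cancel_right_pos)
  then show ?thesis using a \<delta> unfolding T_def[symmetric] by (simp add: pos_le_divide_eq)
qed

section \<open>Two random residues generate the units modulo a prime\<close>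

text \<open>
  If the generated subgroup were proper, Lagrange's theorem would give a prime \<open>q\<close> dividing its index.
  Then its order divides \<open>(p - 1) div q\<close>, so every element of \<open>B\<close> would be killed by that exponent.
\<close>

lemma generate_residue_units:
  fixes p :: nat
  assumes p: "prime p"
    and cop: "\<And>b. b \<in> B \<Longrightarrow> coprime b p"
    and nonpow: "\<And>q. prime q \<Longrightarrow> q dvd p - 1 \<Longrightarrow> \<exists>b\<in>B. \<not> [b ^ ((p - 1) div q) = 1] (mod p)"
  shows "generate (residue_units p) ((\<lambda>a. int a mod int p) ` B) = carrier (residue_units p)"
proof -
  have p1: "p > 1" using p by (rule prime_gt_1_nat)
  define R where "R = residue_ring (int p)"
  interpret residues_prime p R
    by (unfold_locales) (use p in \<open>auto simp: R_def\<close>)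
  define G where "G = units_of R"
  have G: "residue_units p = G" by (simp add: residue_units_def G_def R_def)
  interpret G: group G unfolding G_def by (rule units_group)
  define B' where "B' = (\<lambda>a. int a mod int p) ` B"
  define H where "H = generate G B'"
  have B': "B' \<subseteq> carrier G"
    unfolding B'_def G_def units_of_carrier using cop p1 by (auto intro!: mod_in_res_units)
  have H: "subgroup H G" unfolding H_def by (rule G.generate_is_subgroup[OF B'])
  have orderG: "order G = p - 1"
    unfolding order_def G_def units_of_carrier by (simp add: res_prime_units_eq nat_diff_distrib')
  have lagr: "card (rcosets\<^bsub>G\<^esub> H) * card H = p - 1"
    using G.lagrange[OF H] orderG by simp
  have "H = carrier G"
  proof (rule ccontr)
    assume ne: "H \<noteq> carrier G"
    have finG: "finite (carrier G)" using orderG p1 by (auto simp: order_def intro: card_ge_0_finite)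
    have "H \<subset> carrier G" using ne subgroup.subset[OF H] by auto
    then have "card H < p - 1" using psubset_card_mono[OF finG] orderG by (simp add: order_def)
    then have "card (rcosets\<^bsub>G\<^esub> H) \<noteq> 1" using lagr by auto
    then obtain q where q: "prime q" "q dvd card (rcosets\<^bsub>G\<^esub> H)"
      using prime_factor_nat by blast
    then obtain d where d: "card (rcosets\<^bsub>G\<^esub> H) = q * d" by (elim dvdE)
    have pq: "p - 1 = q * (card H * d)" using lagr d by (simp add: mult_ac)
    then have "q dvd p - 1" by simp
    with nonpow[OF q(1)] obtain b where b: "b \<in> B" "\<not> [b ^ ((p - 1) div q) = 1] (mod p)" by auto
    have e: "(p - 1) div q = card H * d" using pq q(1) by (simp add: prime_gt_0_nat)
    define x where "x = int b mod int p"
    have xH: "x \<in> H" unfolding H_def x_def B'_def using b by (auto intro: generate.incl)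
    have xG: "x \<in> carrier G" using subgroup.subset[OF H] xH by auto
    interpret GH: group "G\<lparr>carrier := H\<rparr>" by (rule subgroup.subgroup_is_group[OF H G.group_axioms])
    have "x [^]\<^bsub>G\<lparr>carrier := H\<rparr>\<^esub> order (G\<lparr>carrier := H\<rparr>) = \<one>\<^bsub>G\<lparr>carrier := H\<rparr>\<^esub>"
      by (rule GH.pow_order_eq_1) (use xH in simp)
    then have "x [^]\<^bsub>G\<^esub> card H = \<one>\<^bsub>G\<^esub>"
      by (simp add: order_def G.nat_pow_consistent[symmetric])
    then have "x [^]\<^bsub>G\<^esub> (card H * d) = \<one>\<^bsub>G\<^esub>"
      using xG by (metis G.nat_pow_one G.nat_pow_pow)
    then have "x [^]\<^bsub>R\<^esub> (card H * d) = 1"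
      using xG units_of_pow unfolding G_def units_of_carrier units_of_one res_one_eq by metis
    then have "int b ^ (card H * d) mod int p = 1"
      unfolding x_def by (simp add: pow_cong)
    then have "int (b ^ (card H * d) mod p) = int 1"
      by (simp add: zmod_int)
    then have "[b ^ (card H * d) = 1] (mod p)"
      using p1 unfolding cong_def of_nat_eq_iff by simp
    with b(2) e show False by simp
  qed
  then show ?thesis by (simp add: G H_def B'_def)
qed

lemma sum_inverse_squares_le:
  assumes "finite Q" "\<And>q. q \<in> Q \<Longrightarrow> q \<ge> (2::nat)"
  shows "(\<Sum>q\<in>Q. 1 / (real q)\<^sup>2) \<le> 3 / 4"
proof -
  have bound: "(\<Sum>q = 2..m. 1 / (real q)\<^sup>2) \<le> 3 / 4 - 1 / real m" if "m \<ge> 2" for m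
    using that
  proof (induction m rule: dec_induct)
    case (step m)
    have "1 / (real (Suc m))\<^sup>2 \<le> 1 / real m - 1 / real (Suc m)"
      using step.hyps by (simp add: divide_simps power2_eq_square)
    with step show ?case by simp
  qed simp
  define m where "m = Max (insert 2 Q)"
  have m: "m \<ge> 2" unfolding m_def using assms(1) by simp
  have "(\<Sum>q\<in>Q. 1 / (real q)\<^sup>2) \<le> (\<Sum>q = 2..m. 1 / (real q)\<^sup>2)"
    using assms by (intro sum_mono2) (auto simp: m_def)
  also have "\<dots> \<le> 3 / 4 - 1 / real m" by (rule bound[OF m])
  finally show ?thesis by (smt (verit) divide_nonneg_nonneg of_nat_0_le_iff)
qed

lemma card_prime_factors_le_log:
  assumes "n > (0::nat)"
  shows "real (card (prime_factors n)) \<le> log 2 (real n)"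
proof -
  have "2 ^ card (prime_factors n) = (\<Prod>q\<in>prime_factors n. 2::nat)" by simp
  also have "\<dots> \<le> (\<Prod>q\<in>prime_factors n. q ^ multiplicity q n)"
  proof (intro prod_mono conjI)
    fix q assume q: "q \<in> prime_factors n"
    then have "multiplicity q n > 0" "q \<ge> 2"
      by (auto simp: prime_factors_multiplicity prime_ge_2_nat)
    then show "2 \<le> q ^ multiplicity q n"
      by (metis self_le_power le_trans one_le_numeral)
  qed auto
  also have "\<dots> = n" using assms by (intro prime_factorization_nat[symmetric])
  finally show ?thesis by (rule le_log2_of_power)
qed

text \<open>
  Choose \<open>a\<close> and \<open>b\<close> at random from \<open>A\<close>. For a prime \<open>q\<close> dividing \<open>p - 1\<close>, the congruence
  \<open>[x ^ ((p - 1) div q) = 1] (mod p)\<close> has at most \<open>(p - 1) div q\<close> solutions, so by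
  equidistribution a random element satisfies it with probability at most \<open>1 / q + \<delta>\<close>.
  Both \<open>a\<close> and \<open>b\<close> satisfy it with probability at most \<open>1 / q\<^sup>2 + 2 * \<delta>\<close>. Over all \<open>q\<close> these
  probabilities sum to less than 1, because the main terms contribute at most \<open>3 / 4\<close> and there are
  at most \<open>log 2 p\<close> error terms. Two elements are needed since the sum of \<open>1 / q\<close> may exceed 1.
\<close>

lemma exists_two_elements_not_powers:
  assumes p: "prime p" and finA: "finite A" and A0: "A \<noteq> {}"
    and \<delta>: "0 \<le> \<delta>" "\<delta> \<le> 1" "8 * \<delta> * log 2 (real p) < 1"
    and var: "residue_variance A p \<le> (\<delta> * real (card A))\<^sup>2"
  shows "\<exists>a\<in>A. \<exists>b\<in>A. \<forall>q. prime q \<longrightarrow> q dvd p - 1 \<longrightarrow>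
    \<not> ([a ^ ((p - 1) div q) = 1] (mod p) \<and> [b ^ ((p - 1) div q) = 1] (mod p))"
proof (rule ccontr)
  assume contr: "\<not> ?thesis"
  have p1: "p > 1" using p by (rule prime_gt_1_nat)
  define K where "K q = {n\<in>A. [n ^ ((p - 1) div q) = 1] (mod p)}" for q
  define Qs where "Qs = prime_factors (p - 1)"
  define a where "a = real (card A)"
  have a0: "a > 0" using finA A0 by (auto simp: a_def card_gt_0_iff)
  have finQ: "finite Qs" by (simp add: Qs_def)
  have Q2: "q \<ge> 2" if "q \<in> Qs" for q
    using that by (auto simp: Qs_def intro: prime_ge_2_nat)
  have cardK: "real (card (K q)) \<le> a * (1 / real q + \<delta>)" if q: "q \<in> Qs" for q
  proof -
    have q': "prime q" "q dvd p - 1" "q > 0"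
      using q Q2[OF q] unfolding Qs_def by (blast intro: in_prime_factors_imp_prime, blast intro: in_prime_factors_imp_dvd, simp)
    define H where "H = {x\<in>{..<p}. [x ^ ((p - 1) div q) = 1] (mod p)}"
    have "(p - 1) div q > 0" using q' p1 dvd_imp_le[OF q'(2)] by (simp add: div_greater_zero_iff)
    then have "card H \<le> (p - 1) div q"
      unfolding H_def using p by (intro roots_mod_prime_bound) auto
    then have "real (card H) \<le> real ((p - 1) div q)" by simp
    also have "\<dots> = real (p - 1) / real q" using q' by (simp add: real_of_nat_div)
    also have "\<dots> \<le> real p / real q" by (intro divide_right_mono) auto
    finally have cH: "real (card H) / real p \<le> 1 / real q"
      using p1 q' by (simp add: field_simps)
    have "K q = {n\<in>A. n mod p \<in> H}"
      using p1 by (auto simp: K_def H_def cong_def power_mod)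
    then have "real (card (K q))
        \<le> real (card H) * real (card A) / real p + sqrt (real (card H) / real p * residue_variance A p)"
      using card_mod_in_le[OF finA, of p H] p1 by (auto simp: H_def)
    also have "real (card H) * real (card A) / real p = (real (card H) / real p) * a"
      by (simp add: a_def)
    also have "\<dots> \<le> 1 / real q * a" using cH a0 by (intro mult_right_mono) auto
    also have "sqrt (real (card H) / real p * residue_variance A p) \<le> \<delta> * a"
    proof (rule real_le_lsqrt)
      have "real (card H) / real p \<le> 1" using order_trans[OF cH, of 1] Q2[OF q] by simp
      then have "real (card H) / real p * residue_variance A p \<le> 1 * (\<delta> * a)\<^sup>2"
        using var by (intro mult_mono) (auto simp: a_def residue_variance_nonneg)
      then show "real (card H) / real p * residue_variance A p \<le> (\<delta> * a)\<^sup>2" by simp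
    qed (use \<delta> a0 in simp)
    finally show ?thesis by (simp add: algebra_simps)
  qed
  have "A \<times> A \<subseteq> (\<Union>q\<in>Qs. K q \<times> K q)"
  proof clarify
    fix x y assume "x \<in> A" "y \<in> A"
    with contr obtain q where "prime q" "q dvd p - 1"
      "[x ^ ((p - 1) div q) = 1] (mod p)" "[y ^ ((p - 1) div q) = 1] (mod p)" by blast
    with p1 \<open>x \<in> A\<close> \<open>y \<in> A\<close> show "(x, y) \<in> (\<Union>q\<in>Qs. K q \<times> K q)"
      by (auto simp: Qs_def K_def in_prime_factors_iff)
  qed
  then have "card (A \<times> A) \<le> card (\<Union>q\<in>Qs. K q \<times> K q)"
    using finQ finA by (intro card_mono) (auto simp: K_def)
  also have "\<dots> \<le> (\<Sum>q\<in>Qs. card (K q \<times> K q))" by (rule card_UN_le[OF finQ])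
  finally have "real (card (A \<times> A)) \<le> real (\<Sum>q\<in>Qs. card (K q \<times> K q))" by (rule of_nat_mono)
  then have "a * a \<le> (\<Sum>q\<in>Qs. real (card (K q)) * real (card (K q)))"
    by (simp add: a_def card_cartesian_product)
  also have "\<dots> \<le> (\<Sum>q\<in>Qs. a\<^sup>2 * (1 / (real q)\<^sup>2 + 2 * \<delta>))"
  proof (intro sum_mono)
    fix q assume q: "q \<in> Qs"
    have "real (card (K q)) * real (card (K q)) \<le> (a * (1 / real q + \<delta>)) * (a * (1 / real q + \<delta>))"
      using cardK[OF q] a0 \<delta> by (intro mult_mono) auto
    also have "\<dots> = a\<^sup>2 * (1 / (real q)\<^sup>2 + (2 / real q + \<delta>) * \<delta>)"
      by (simp add: power2_eq_square algebra_simps)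
    also have "\<dots> \<le> a\<^sup>2 * (1 / (real q)\<^sup>2 + 2 * \<delta>)"
    proof -
      have "2 / real q \<le> 1" using Q2[OF q] by simp
      then have "(2 / real q + \<delta>) * \<delta> \<le> 2 * \<delta>" using \<delta> by (intro mult_right_mono) auto
      then show ?thesis by (intro mult_left_mono) auto
    qed
    finally show "real (card (K q)) * real (card (K q)) \<le> a\<^sup>2 * (1 / (real q)\<^sup>2 + 2 * \<delta>)" .
  qed
  also have "\<dots> = a\<^sup>2 * ((\<Sum>q\<in>Qs. 1 / (real q)\<^sup>2) + 2 * \<delta> * real (card Qs))"
    by (simp add: sum.distrib flip: sum_distrib_left)
  also have "\<dots> < a\<^sup>2 * 1"
  proof (intro mult_strict_left_mono)
    have "real (card Qs) \<le> log 2 (real (p - 1))"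
      unfolding Qs_def using p1 by (intro card_prime_factors_le_log) simp
    also have "\<dots> \<le> log 2 (real p)" using p1 by simp
    finally have "2 * \<delta> * real (card Qs) \<le> 2 * \<delta> * log 2 (real p)"
      using \<delta> by (intro mult_left_mono) auto
    then have "2 * \<delta> * real (card Qs) < 1 / 4" using \<delta> by linarith
    with sum_inverse_squares_le[OF finQ Q2]
    show "(\<Sum>q\<in>Qs. 1 / (real q)\<^sup>2) + 2 * \<delta> * real (card Qs) < 1" by linarith
  qed (use a0 in simp)
  finally show False by (simp add: power2_eq_square)
qed

section \<open>Products of small primes\<close>

text \<open>
  Products of distinct primes are used because they determine their factors, so that this set is as
  large as the number of \<open>k\<close>-subsets. It reaches up to \<open>y ^ k\<close>, the length that the large sieve
  requires, while each element is generated by \<open>k\<close> integers of size at most \<open>y\<close>.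
\<close>

definition prime_products :: "nat \<Rightarrow> nat \<Rightarrow> nat set" where
  "prime_products k y = \<Prod> ` {S. S \<subseteq> {p. prime p \<and> p \<le> y} \<and> card S = k}"

lemma finite_prime_products: "finite (prime_products k y)"
  unfolding prime_products_def by (rule finite_imageI, rule finite_subset[of _ "Pow {p. prime p \<and> p \<le> y}"]) auto

lemma prime_products_le: "n \<in> prime_products k y \<Longrightarrow> n \<le> y ^ k"
proof -
  assume "n \<in> prime_products k y"
  then obtain S where S: "S \<subseteq> {p. prime p \<and> p \<le> y}" "card S = k" "n = \<Prod>S"
    by (auto simp: prime_products_def)
  have "\<Prod>S \<le> (\<Prod>p\<in>S. y)" using S by (intro prod_mono) auto
  with S show ?thesis by simp
qed

lemma card_prime_products:
  "card (prime_products k y) = card {p::nat. prime p \<and> p \<le> y} choose k"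
proof -
  define P where "P = {p::nat. prime p \<and> p \<le> y}"
  have finP: "finite P" by (simp add: P_def)
  have pf: "prime_factors (\<Prod>S) = S" if "S \<subseteq> P" for S
  proof -
    have "finite S" using that finP finite_subset by blast
    moreover have "prime p" if "p \<in> S" for p using that \<open>S \<subseteq> P\<close> by (auto simp: P_def)
    ultimately show ?thesis
      by (subst prime_factors_prod) (auto simp: prime_prime_factors dest: prime_gt_0_nat)
  qed
  have "inj_on \<Prod> {S. S \<subseteq> P \<and> card S = k}"
    by (rule inj_on_inverseI[where g = prime_factors]) (use pf in auto)
  then show ?thesis
    unfolding prime_products_def P_def[symmetric] by (simp add: card_image n_subsets[OF finP])
qed

lemma card_prime_products_lower:
  assumes "k > 0" "real k * z \<le> real (card {p::nat. prime p \<and> p \<le> y})" "z \<ge> 1"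
  shows "z ^ k \<le> real (card (prime_products k y))"
proof -
  define M where "M = card {p::nat. prime p \<and> p \<le> y}"
  have kz: "real k * z \<le> real M" using assms by (simp add: M_def)
  have "real k * 1 \<le> real k * z" using assms by (intro mult_left_mono) auto
  then have "k \<le> M" using kz by linarith
  have "z ^ k \<le> (real M / real k) ^ k"
    using kz assms by (intro power_mono) (auto simp: field_simps)
  also have "\<dots> \<le> real (M choose k)" by (rule binomial_ge_n_over_k_pow_k) (rule \<open>k \<le> M\<close>)
  finally show ?thesis unfolding card_prime_products M_def .
qed

text \<open>
  If a product of primes is not killed by an exponent modulo \<open>p\<close>, then one of its prime factors is
  not. Hence the prime factors of the two random products generate all units.
\<close>

lemma exists_generating_primes:
  assumes p: "prime p" and y: "y < p" and ne: "prime_products k y \<noteq> {}"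
    and \<delta>: "0 \<le> \<delta>" "\<delta> \<le> 1" "8 * \<delta> * log 2 (real p) < 1"
    and var: "residue_variance (prime_products k y) p \<le> (\<delta> * real (card (prime_products k y)))\<^sup>2"
  shows "\<exists>S. S \<subseteq> {q. prime q \<and> q \<le> y} \<and> card S \<le> 2 * k \<and>
    generate (residue_units p) ((\<lambda>a. int a mod int p) ` S) = carrier (residue_units p)"
proof -
  obtain a b where ab: "a \<in> prime_products k y" "b \<in> prime_products k y"
    and npow: "\<And>q. prime q \<Longrightarrow> q dvd p - 1 \<Longrightarrow>
      \<not> ([a ^ ((p - 1) div q) = 1] (mod p) \<and> [b ^ ((p - 1) div q) = 1] (mod p))"
    using exists_two_elements_not_powers[OF p finite_prime_products ne \<delta> var] by blast
  obtain S where S: "S \<subseteq> {q. prime q \<and> q \<le> y}" "card S = k" "a = \<Prod>S"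
    using ab(1) by (auto simp: prime_products_def)
  obtain T where T: "T \<subseteq> {q. prime q \<and> q \<le> y}" "card T = k" "b = \<Prod>T"
    using ab(2) by (auto simp: prime_products_def)
  have prod_pow: "[(\<Prod>U) ^ e = 1] (mod p)" if "\<And>s. s \<in> U \<Longrightarrow> [s ^ e = 1] (mod p)" for U :: "nat set" and e
  proof -
    have "[(\<Prod>s\<in>U. s ^ e) = (\<Prod>s\<in>U. 1)] (mod p)" using that by (rule cong_prod)
    then show ?thesis by (simp add: prod_power_distrib)
  qed
  have "generate (residue_units p) ((\<lambda>a. int a mod int p) ` (S \<union> T)) = carrier (residue_units p)"
  proof (rule generate_residue_units[OF p])
    fix s assume "s \<in> S \<union> T"
    then have "prime s" "s < p" using S T y by auto
    then show "coprime s p" using p by (intro primes_coprime) auto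
  next
    fix q assume q: "prime q" "q dvd p - 1"
    show "\<exists>s\<in>S \<union> T. \<not> [s ^ ((p - 1) div q) = 1] (mod p)"
    proof (rule ccontr)
      assume "\<not> ?thesis"
      then have "[a ^ ((p - 1) div q) = 1] (mod p)" "[b ^ ((p - 1) div q) = 1] (mod p)"
        unfolding S(3) T(3) by (blast intro: prod_pow)+
      with npow[OF q] show False by blast
    qed
  qed
  moreover have "card (S \<union> T) \<le> 2 * k" using card_Un_le[of S T] S(2) T(2) by simp
  moreover have "S \<union> T \<subseteq> {q. prime q \<and> q \<le> y}" using S(1) T(1) by (rule Un_least)
  ultimately show ?thesis by blast
qed

lemma h_le_card:
  assumes "small_generating_set \<epsilon> p S" "card S \<le> n"
  shows "h \<epsilon> p \<le> enat n"
proof -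
  have "S \<in> {S. small_generating_set \<epsilon> p S}" using assms(1) by (rule CollectI)
  then have "(INF S \<in> {S. small_generating_set \<epsilon> p S}. enat (card S)) \<le> enat (card S)"
    by (rule INF_lower)
  then have "h \<epsilon> p \<le> enat (card S)" by (simp only: h_def)
  moreover have "enat (card S) \<le> enat n" by (simp only: enat_ord_simps assms(2))
  ultimately show ?thesis by (rule order_trans)
qed

section \<open>Almost all primes\<close>

lemma card_primes_le_pos: "x \<ge> 2 \<Longrightarrow> card {p::nat. prime p \<and> real p \<le> x} > 0"
proof -
  assume "x \<ge> 2"
  then have "2 \<in> {p::nat. prime p \<and> real p \<le> x}" by simp
  moreover have "finite {p::nat. prime p \<and> real p \<le> x}"
    by (rule finite_subset[of _ "{..nat \<lfloor>x\<rfloor>}"]) (auto simp: le_nat_floor)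
  ultimately show ?thesis unfolding card_gt_0_iff by blast
qed

text \<open>
  An exceptional set of size \<open>O(sqrt x)\<close> is negligible against the Chebyshev bound.
\<close>

lemma almost_all_primesI:
  assumes "\<forall>\<^sub>F x in at_top. real (card {p::nat. prime p \<and> real p \<le> x \<and> \<not> P p}) \<le> c * sqrt x"
  shows "almost_all_primes P"
proof -
  define \<pi> where "\<pi> x = real (card {p::nat. prime p \<and> real p \<le> x})" for x :: real
  define good where "good x = real (card {p::nat. prime p \<and> real p \<le> x \<and> P p})" for x :: real
  define bad where "bad x = real (card {p::nat. prime p \<and> real p \<le> x \<and> \<not> P p})" for x :: real
  have split: "\<pi> x = good x + bad x" for x
  proof -
    have "finite {p::nat. prime p \<and> real p \<le> x \<and> R p}" for R
      by (rule finite_subset[of _ "{..nat \<lfloor>x\<rfloor>}"]) (auto simp: le_nat_floor)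
    moreover have "{p::nat. prime p \<and> real p \<le> x}
      = {p::nat. prime p \<and> real p \<le> x \<and> P p} \<union> {p::nat. prime p \<and> real p \<le> x \<and> \<not> P p}" by auto
    ultimately show ?thesis
      unfolding \<pi>_def good_def bad_def by (simp add: card_Un_disjoint disjoint_iff)
  qed
  have "((\<lambda>x. bad x / \<pi> x) \<longlongrightarrow> 0) at_top"
  proof (rule tendsto_sandwich)
    show "\<forall>\<^sub>F x in at_top. 0 \<le> bad x / \<pi> x"
      by (simp add: bad_def \<pi>_def)
    show "\<forall>\<^sub>F x in at_top. bad x / \<pi> x \<le> c * sqrt x / ((x - 2) * ln 2 / ln x)"
      using assms eventually_gt_at_top[of 2]
    proof eventually_elim
      case (elim x)
      have "(x - 2) * ln 2 / ln x > 0" using elim(2) by simp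
      moreover have "bad x \<ge> 0" by (simp add: bad_def)
      ultimately show ?case
        using elim card_primes_lower_bound[of x] unfolding bad_def[symmetric] \<pi>_def[symmetric]
        by (intro frac_le) auto
    qed
    show "((\<lambda>x. c * sqrt x / ((x - 2) * ln 2 / ln x)) \<longlongrightarrow> 0) at_top" by real_asymp
  qed auto
  then have "((\<lambda>x. 1 - bad x / \<pi> x) \<longlongrightarrow> 1 - 0) at_top" by (intro tendsto_intros)
  then have "((\<lambda>x. 1 - bad x / \<pi> x) \<longlongrightarrow> 1) at_top" by simp
  moreover have "\<forall>\<^sub>F x in at_top. 1 - bad x / \<pi> x = good x / \<pi> x"
    using eventually_ge_at_top[of 2]
  proof eventually_elim
    case (elim x)
    then have "\<pi> x > 0" unfolding \<pi>_def using card_primes_le_pos by simp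
    then show ?case using split[of x] by (simp add: field_simps)
  qed
  ultimately have "((\<lambda>x. good x / \<pi> x) \<longlongrightarrow> 1) at_top" by (rule Lim_transform_eventually)
  then show ?thesis unfolding almost_all_primes_def good_def \<pi>_def .
qed

lemma one_eighth_le_exponent: "1 / 8 \<le> 1 / (4 * sqrt (exp 1 :: real))"
proof -
  have "sqrt (exp 1 :: real) \<le> sqrt 4" using e_less_272 by (intro real_sqrt_le_mono) simp
  then show ?thesis by (simp add: field_simps)
qed

text \<open>
  The range \<open>sqrt x < p \<le> x\<close> lets one set of products serve all primes \<open>p\<close> at once: its prime
  factors are at most \<open>x powr (1/16)\<close>, which is less than \<open>p powr (1/8)\<close> and hence admissible for every
  positive \<open>\<epsilon>\<close>. The number 48 of factors is chosen so that the products reach \<open>x ^ 3\<close>, and the two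
  products together have at most 96 prime factors.
\<close>

lemma exists_small_generators_of_small_variance:
  fixes x \<epsilon> :: real and p :: nat
  defines "A \<equiv> prime_products 48 (nat \<lfloor>x powr (1/16)\<rfloor>)"
  assumes \<epsilon>: "\<epsilon> > 0" and p: "prime p" and px: "real p \<le> x" and xp: "sqrt x < real p" and x: "x > 1"
    and log: "8 * x powr (-1/16) * log 2 x < 1" and ne: "A \<noteq> {}"
    and var: "residue_variance A p \<le> (x powr (-1/16) * real (card A))\<^sup>2"
  shows "h \<epsilon> p \<le> enat 96"
proof -
  define y where "y = nat \<lfloor>x powr (1/16)\<rfloor>"
  define \<delta> where "\<delta> = x powr (-1/16)"
  have y: "real y \<le> x powr (1/16)" unfolding y_def by simp
  have p1: "real p > 1" using prime_gt_1_nat[OF p] by simp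
  have "x powr (1/16) = sqrt x powr (1/8)"
    using x by (simp add: powr_half_sqrt[symmetric] powr_powr)
  also have "\<dots> < real p powr (1/8)" using xp x by (intro powr_less_mono2) auto
  finally have yp: "real y < real p powr (1/8)" using y by linarith
  also have "real p powr (1/8) \<le> real p powr 1" using p1 by (intro powr_mono) auto
  finally have yp1: "y < p" using p1 by simp
  have \<delta>: "0 \<le> \<delta>" "\<delta> \<le> 1" "8 * \<delta> * log 2 (real p) < 1"
  proof -
    show "0 \<le> \<delta>" by (simp add: \<delta>_def)
    show "\<delta> \<le> 1" using x powr_mono[of "-1/16" 0 x] by (simp add: \<delta>_def)
    have "8 * \<delta> * log 2 (real p) \<le> 8 * \<delta> * log 2 x"
      using px p1 by (intro mult_left_mono) (auto simp: \<delta>_def)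
    then show "8 * \<delta> * log 2 (real p) < 1" using log by (simp add: \<delta>_def)
  qed
  obtain S where S: "S \<subseteq> {q. prime q \<and> q \<le> y}" "card S \<le> 2 * 48"
    "generate (residue_units p) ((\<lambda>a. int a mod int p) ` S) = carrier (residue_units p)"
    using exists_generating_primes[OF p yp1 _ \<delta>, of 48] ne var
    unfolding A_def y_def \<delta>_def by blast
  have "small_generating_set \<epsilon> p S"
    unfolding small_generating_set_def
  proof (intro conjI ballI S(3))
    fix a assume a: "a \<in> S"
    then have a': "prime a" "a \<le> y" using S by auto
    show "0 < a" using a' by (simp add: prime_gt_0_nat)
    show "coprime a p" using a' yp1 p by (intro primes_coprime) auto
    have "real a < real p powr (1/8)" using a' yp by simp
    also have "\<dots> \<le> real p powr (1 / (4 * sqrt (exp 1)) + \<epsilon>)"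
    proof (rule powr_mono)
      show "1 / 8 \<le> 1 / (4 * sqrt (exp 1)) + \<epsilon>" using one_eighth_le_exponent \<epsilon> by linarith
    qed (use p1 in simp)
    finally show "real a < real p powr (1 / (4 * sqrt (exp 1)) + \<epsilon>)" .
  qed
  then show ?thesis using S(2) by (intro h_le_card) auto
qed

lemma log3_mono:
  assumes "exp (exp 1) \<le> a" "a \<le> b"
  shows "log3 a \<le> log3 b"
proof -
  have a0: "a > 0" using assms(1) by (smt (verit) exp_gt_zero)
  have "exp 1 \<le> ln a" using assms(1) a0 by (simp add: ln_ge_iff)
  moreover have "ln a \<le> ln b" using assms(2) a0 by simp
  moreover have "(1::real) < exp 1" by simp
  ultimately have l: "1 < ln a" "ln a \<le> ln b" by linarith+
  then have "0 < ln (ln a)" "ln (ln a) \<le> ln (ln b)" by (simp_all add: ln_gt_zero)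
  then show ?thesis unfolding log3_def by simp
qed

theorem corollary3p7:
  fixes \<epsilon> :: real
  assumes "\<epsilon> > 0"
  shows "\<exists>C::real. C > 0 \<and>
    almost_all_primes (\<lambda>p. ereal_of_enat (h \<epsilon> p) \<le> ereal (C * (log3 (real p))\<^sup>2))"
proof (intro exI[of _ 1] conjI)
  define P where "P p \<longleftrightarrow> ereal_of_enat (h \<epsilon> p) \<le> ereal (1 * (log3 (real p))\<^sup>2)" for p
  define A where "A x = prime_products 48 (nat \<lfloor>x powr (1/16)\<rfloor>)" for x :: real
  have ev1: "\<forall>\<^sub>F x::real in at_top. 8 * x powr (-1/16) * log 2 x < 1" by real_asymp
  \<comment> \<open>The exponent \<open>7/128 = 7/8 * 1/16\<close> leaves room for the logarithm in Chebyshev's bound, and its 48th power is \<open>x powr (21/8)\<close>.\<close>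
  have ev2: "\<forall>\<^sub>F x::real in at_top. 48 * x powr (7/128) \<le> (x powr (1/16) - 2) * ln 2 / ln (x powr (1/16))"
    by real_asymp
  have ev3: "\<forall>\<^sub>F x::real in at_top. 10 \<le> log3 (sqrt x)" unfolding log3_def by real_asymp
  have ev4: "\<forall>\<^sub>F x::real in at_top. exp (exp 1) \<le> sqrt x" by real_asymp
  have ev5: "\<forall>\<^sub>F x::real in at_top. 2 \<le> x powr (1/16)" by real_asymp
  have "\<forall>\<^sub>F x in at_top. real (card {p::nat. prime p \<and> real p \<le> x \<and> \<not> P p}) \<le> 4 * sqrt x"
    using ev1 ev2 ev3 ev4 ev5 eventually_ge_at_top[of 2]
  proof eventually_elim
    case (elim x)
    define y where "y = nat \<lfloor>x powr (1/16)\<rfloor>"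
    define Q where "Q = nat \<lfloor>x\<rfloor>"
    define \<delta> where "\<delta> = x powr (-1/16)"
    define T where "T = {p. prime p \<and> p \<le> Q \<and> residue_variance (A x) p > (\<delta> * real (card (A x)))\<^sup>2}"
    have x: "x \<ge> 2" by fact
    have y: "real y \<le> x powr (1/16)" unfolding y_def by simp
    have Q: "real Q \<le> x" unfolding Q_def using x by simp
    have le_y: "q \<le> y \<longleftrightarrow> real q \<le> x powr (1/16)" and le_Q: "q \<le> Q \<longleftrightarrow> real q \<le> x" for q :: nat
      using x unfolding y_def Q_def by (simp_all add: le_nat_floor le_nat_iff le_floor_iff)
    have "48 * x powr (7/128) \<le> real (card {p::nat. prime p \<and> p \<le> y})"
      using card_primes_lower_bound[OF elim(5)] elim(2) unfolding le_y by linarith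
    moreover have "x powr (7/128) \<ge> 1" using x by (simp add: ge_one_powr_ge_zero)
    ultimately have "(x powr (7/128)) ^ 48 \<le> real (card (A x))"
      unfolding A_def y_def[symmetric] by (intro card_prime_products_lower) auto
    then have cardA: "x powr (21/8) \<le> real (card (A x))"
      using x by (simp add: powr_power)
    then have A0: "A x \<noteq> {}" using x by (auto simp: powr_gt_zero not_le)
    define N where "N = y ^ 48 + 1"
    have AN: "A x \<subseteq> {..<N}"
      unfolding A_def y_def[symmetric] N_def using prime_products_le by fastforce
    have "real N = real y ^ 48 + 1" by (simp add: N_def)
    also have "real y ^ 48 \<le> (x powr (1/16)) ^ 48" using y by (intro power_mono) auto
    also have "\<dots> = x powr 3" using x by (simp add: powr_power)
    also have "\<dots> = x ^ 3" using x by simp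
    finally have N: "real N \<le> x ^ 3 + 1" by simp
    have "real Q ^ 3 \<le> x ^ 3" using Q by (intro power_mono) auto
    then have "real (N + Q + Q ^ 3) \<le> x ^ 3 + 1 + x + x ^ 3"
      unfolding of_nat_add of_nat_power using N Q by linarith
    also have "\<dots> \<le> 3 * x ^ 3"
    proof -
      have "x * 4 \<le> x * (x * x)" using x mult_mono[of 2 x 2 x] by (intro mult_left_mono) auto
      then have "1 + x \<le> x ^ 3" unfolding power3_eq_cube mult.assoc using x by linarith
      then show ?thesis by simp
    qed
    finally have NQ: "real (N + Q + Q ^ 3) \<le> 3 * x ^ 3" .
    have "real (card T) \<le> real (N + Q + Q ^ 3) / (\<delta>\<^sup>2 * real (card (A x)))"
      unfolding T_def using x by (intro card_large_variance_le[OF AN A0]) (simp add: \<delta>_def)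
    also have "\<dots> \<le> 3 * x ^ 3 / (\<delta>\<^sup>2 * x powr (21/8))"
      using NQ cardA x by (intro frac_le mult_left_mono mult_pos_pos) (auto simp: \<delta>_def)
    also have "\<delta>\<^sup>2 * x powr (21/8) = x powr (5/2)"
      using x by (simp add: \<delta>_def powr_power flip: powr_add)
    also have "3 * x ^ 3 / x powr (5/2) = 3 * (x powr 3 / x powr (5/2))"
      using x by simp
    also have "x powr 3 / x powr (5/2) = sqrt x"
      unfolding powr_diff[symmetric] using x by (simp add: powr_half_sqrt)
    finally have cardT: "real (card T) \<le> 3 * sqrt x" .
    \<comment> \<open>Primes up to \<open>sqrt x\<close> are discarded; any other exceptional prime has large variance.\<close>
    have "{p::nat. prime p \<and> real p \<le> x \<and> \<not> P p} \<subseteq> {1..nat \<lfloor>sqrt x\<rfloor>} \<union> T"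
    proof
      fix p assume "p \<in> {p::nat. prime p \<and> real p \<le> x \<and> \<not> P p}"
      then have p: "prime p" "real p \<le> x" "\<not> P p" by auto
      show "p \<in> {1..nat \<lfloor>sqrt x\<rfloor>} \<union> T"
      proof (rule ccontr)
        assume n: "p \<notin> {1..nat \<lfloor>sqrt x\<rfloor>} \<union> T"
        then have xp: "sqrt x < real p"
          using prime_gt_0_nat[OF p(1)] le_nat_floor[of p "sqrt x"] by force
        have var: "residue_variance (A x) p \<le> (\<delta> * real (card (A x)))\<^sup>2"
          using n p le_Q by (auto simp: T_def)
        have log: "10 \<le> log3 (real p)"
          using log3_mono[OF elim(4)] xp elim(3) by (meson less_imp_le order_trans)
        have "h \<epsilon> p \<le> enat 96"
          using var assms p xp x elim(1) A0 unfolding A_def \<delta>_def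
          by (intro exists_small_generators_of_small_variance[of \<epsilon> p x]) auto
        then have "ereal_of_enat (h \<epsilon> p) \<le> ereal_of_enat (enat 96)"
          by (simp only: ereal_of_enat_le_iff)
        \<comment> \<open>The bound 96 is absorbed by \<open>(log3 p)\<^sup>2\<close>, which tends to infinity.\<close>
        also have "\<dots> \<le> ereal (10\<^sup>2)" by simp
        also have "ereal (10\<^sup>2) \<le> ereal ((log3 (real p))\<^sup>2)"
          unfolding ereal_less_eq(3) using log by (rule power_mono) simp
        finally have "P p" by (simp add: P_def)
        with p show False by simp
      qed
    qed
    then have "card {p::nat. prime p \<and> real p \<le> x \<and> \<not> P p} \<le> card ({1..nat \<lfloor>sqrt x\<rfloor>} \<union> T)"
      by (intro card_mono) (auto simp: T_def)
    also have "\<dots> \<le> nat \<lfloor>sqrt x\<rfloor> + card T" using card_Un_le[of "{1..nat \<lfloor>sqrt x\<rfloor>}" T] by simp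
    finally have "real (card {p::nat. prime p \<and> real p \<le> x \<and> \<not> P p}) \<le> real (nat \<lfloor>sqrt x\<rfloor>) + real (card T)"
      by linarith
    moreover have "real (nat \<lfloor>sqrt x\<rfloor>) \<le> sqrt x" using x by simp
    ultimately show ?case using cardT by linarith
  qed
  then show "almost_all_primes (\<lambda>p. ereal_of_enat (h \<epsilon> p) \<le> ereal (1 * (log3 (real p))\<^sup>2))"
    unfolding P_def by (rule almost_all_primesI)
qed simp

end
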